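(* For any positive integers $r\le d$, the ordinary generating function $G_{d,r}(x)=\sum_{s=1}^{\infty}N_{d,r}(s)x^s$ equals $$G_{d,r}(x)=\frac{x\bigl(1+(r-1)x^d-rx^{d+1}\bigr)}{(1-x-x^{d+1})(1-x)}$$ (as formal power series).
   Context: A partition $\lambda=(\lambda_1,\dots,\lambda_k)$ is a finite nonincreasing sequence of positive integers (the empty partition is allowed). In its Young diagram (row $i$ has $\lambda_i$ left-justified cells), the hook length $h(i,j)$ of cell $(i,j)$ is $1$ plus the number of cells to its right in its row plus the number of cells below it in its column. For a positive integer $t$, $\lambda$ is $t$-core if no cell has hook length $t$; it is $(s,s+r)$-core if it is both $s$-core and $(s+r)$-core. $\lambda$ has $d$-distinct parts if $\lambda_i-\lambda_{i+1}\ge d$ for all $1\le i\le k-1$. For positive integers $d,r,s$, $N_{d,r}(s)$ is the number of $(s,s+r)$-core partitions with $d$-distinct parts. *)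

theory Defs
  imports "HOL-Computational_Algebra.Formal_Power_Series"
begin

definition is_partition :: "nat list \<Rightarrow> bool" where
  "is_partition p \<longleftrightarrow> sorted_wrt (\<ge>) p \<and> (\<forall>a \<in> set p. 0 < a)"

text \<open>Rows and columns are numbered from 0.\<close>

definition young_diagram :: "nat list \<Rightarrow> (nat \<times> nat) set" where
  "young_diagram p = {(i, j). i < length p \<and> j < p ! i}"

definition hook_length :: "nat list \<Rightarrow> nat \<times> nat \<Rightarrow> nat" where
  "hook_length p = (\<lambda>(i, j).
     1 + card {j'. j < j' \<and> (i, j') \<in> young_diagram p}
       + card {i'. i < i' \<and> (i', j) \<in> young_diagram p})"

definition is_core :: "nat \<Rightarrow> nat list \<Rightarrow> bool" where
  "is_core t p \<longleftrightarrow> (\<forall>c \<in> young_diagram p. hook_length p c \<noteq> t)"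

definition distinct_parts :: "nat \<Rightarrow> nat list \<Rightarrow> bool" where
  "distinct_parts d p \<longleftrightarrow> (\<forall>i. Suc i < length p \<longrightarrow> p ! Suc i + d \<le> p ! i)"

definition core_partitions :: "nat \<Rightarrow> nat \<Rightarrow> nat \<Rightarrow> nat list set" where
  "core_partitions d r s =
     {p. is_partition p \<and> is_core s p \<and> is_core (s + r) p \<and> distinct_parts d p}"

text \<open>
  The cardinality of an infinite set is 0, whereas the empty partition belongs to
  \<^term>\<open>core_partitions d r s\<close> whenever \<open>s > 0\<close>; so a positive value of \<open>num_cores d r s\<close>
  includes the finiteness of that set.
\<close>

definition num_cores :: "nat \<Rightarrow> nat \<Rightarrow> nat \<Rightarrow> nat" where
  "num_cores d r s = card (core_partitions d r s)"

definition core_gf :: "nat \<Rightarrow> nat \<Rightarrow> rat fps" where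
  "core_gf d r = Abs_fps (\<lambda>s. if s = 0 then 0 else of_nat (num_cores d r s))"

end

theory Submission
  imports Defs
begin

text \<open>
  A partition is encoded by the set \<open>X\<close> of its first-column hook lengths. In these terms
  \<open>d\<close>-distinct parts means that any two elements of \<open>X\<close> differ by more than \<open>d\<close>, and
  \<open>t\<close>-core means that \<open>x - t \<in> X\<close> whenever \<open>t \<le> x \<in> X\<close>. As \<open>r \<le> d\<close>, an element
  \<open>x \<ge> s + r\<close> would force \<open>x - s\<close> and \<open>x - s - r\<close> into \<open>X\<close>, which are too close. Hence either
  \<open>X \<subseteq> {1..s-1}\<close>, or \<open>X\<close> has a single element \<open>s + a\<close> above \<open>s\<close> with \<open>1 \<le> a < r\<close>, and then
  \<open>a = Min X\<close> and the elements strictly between lie in an interval of \<open>s - 2d - 1\<close> numbers. With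
  \<open>F n\<close> the number of \<open>d\<close>-spaced subsets of \<open>{1..n}\<close>, this gives
  \<open>N(s) = F (s - 1) + (r - 1) [s > d] F (s - 2d - 1)\<close>, where \<open>F (n + 1) = F n + F (n - d)\<close>,
  both with truncated subtraction.
\<close>

section \<open>First-column hook lengths\<close>

text \<open>In a partition \<open>a # p\<close> the leftmost cell of the first row has arm
  \<open>a - 1\<close> and leg \<open>length p\<close>, so its hook length is
  \<open>a + length p\<close>.\<close>

fun beta_set :: "nat list \<Rightarrow> nat set" where
  "beta_set [] = {}"
| "beta_set (a # p) = insert (a + length p) (beta_set p)"

lemma finite_beta_set [simp]: "finite (beta_set p)"
  by (induction p) auto

lemma is_partition_Nil [simp]: "is_partition []"
  by (simp add: is_partition_def)

lemma is_partition_Cons: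
  "is_partition (a # p) \<longleftrightarrow> 0 < a \<and> (\<forall>b\<in>set p. b \<le> a) \<and> is_partition p"
  by (auto simp: is_partition_def)

lemma beta_set_less:
  assumes "\<forall>b\<in>set p. b \<le> a" "x \<in> beta_set p"
  shows "x < a + length p"
  using assms by (induction p) auto

lemma card_beta_set: "is_partition p \<Longrightarrow> card (beta_set p) = length p"
proof (induction p)
  case (Cons a p)
  then have "a + length p \<notin> beta_set p"
    using beta_set_less[of p a "a + length p"] by (auto simp: is_partition_Cons)
  with Cons show ?case by (simp add: is_partition_Cons)
qed auto

lemma zero_notin_beta_set: "is_partition p \<Longrightarrow> 0 \<notin> beta_set p"
  by (induction p) (auto simp: is_partition_Cons)

text \<open>For a row of length \<open>a\<close> above \<open>p\<close> and \<open>j < a\<close>,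
  the hook length in column \<open>j\<close> is \<open>a + length p\<close> minus this number.
  Strict monotonicity makes these numbers distinct.\<close>

lemma strict_mono_add_length_filter_le:
  "strict_mono (\<lambda>j::nat. j + length (filter (\<lambda>v. v \<le> j) p))"
proof (rule strict_monoI)
  fix i j :: nat assume "i < j"
  then have "length (filter (\<lambda>v. v \<le> i) p) \<le> length (filter (\<lambda>v. v \<le> j) p)"
    by (induction p) auto
  with \<open>i < j\<close> show "i + length (filter (\<lambda>v. v \<le> i) p) < j + length (filter (\<lambda>v. v \<le> j) p)"
    by simp
qed

text \<open>Compare with the largest part \<open>b\<close>. If \<open>b \<le> j\<close>, every part
  is counted and the number exceeds all of the beta set. Otherwise \<open>b\<close> is not counted
  and the number stays below \<open>b + length p\<close>, so induction applies.\<close>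

lemma add_length_filter_le_notin_beta_set:
  assumes "is_partition p"
  shows "j + length (filter (\<lambda>v. v \<le> j) p) \<notin> beta_set p"
  using assms
proof (induction p)
  case (Cons b p)
  then have b: "\<forall>v\<in>set p. v \<le> b" and p: "is_partition p"
    by (auto simp: is_partition_Cons)
  show ?case
  proof (cases "b \<le> j")
    case True
    with b have "filter (\<lambda>v. v \<le> j) p = p" by (intro filter_True) auto
    with True show ?thesis using beta_set_less[OF b, of "Suc (j + length p)"] by auto
  next
    case False
    then have "j + length (filter (\<lambda>v. v \<le> j) p) < b + length p"
      by (simp add: add_less_le_mono)
    with False show ?thesis
      using Cons.IH[OF p] by simp
  qed
qed auto

text \<open>Both sides have \<open>a\<close> elements, so the inclusion of the left in the right is an equality.\<close>

lemma image_add_length_filter_le: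
  assumes "is_partition p" "\<forall>b\<in>set p. b \<le> a"
  shows "(\<lambda>j. j + length (filter (\<lambda>v. v \<le> j) p)) ` {..<a} = {..<a + length p} - beta_set p"
    (is "?g ` _ = _")
proof (rule card_subset_eq)
  show "?g ` {..<a} \<subseteq> {..<a + length p} - beta_set p"
    using add_length_filter_le_notin_beta_set[OF assms(1)]
    by (auto intro!: add_less_le_mono length_filter_le)
  have "card (?g ` {..<a}) = a"
    using strict_mono_add_length_filter_le[of p] strict_mono_imp_inj_on[of ?g]
    by (subst card_image) (auto intro: inj_on_subset)
  moreover have "beta_set p \<subseteq> {..<a + length p}"
    using beta_set_less[OF assms(2)] by auto
  ultimately show "card (?g ` {..<a}) = card ({..<a + length p} - beta_set p)"
    by (simp add: card_Diff_subset card_beta_set assms(1))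
qed auto

section \<open>Hook lengths row by row and the core condition\<close>

lemma hook_length_Cons_Suc: "hook_length (a # p) (Suc i, j) = hook_length p (i, j)"
proof -
  have "{i'. Suc i < i' \<and> i' < Suc (length p) \<and> j < (a # p) ! i'} =
      Suc ` {i'. i < i' \<and> i' < length p \<and> j < p ! i'}"
    by (auto simp: image_iff elim!: Suc_lessE)
  then show ?thesis
    by (simp add: hook_length_def young_diagram_def card_image)
qed

text \<open>The arm is \<open>a - 1 - j\<close>, and the leg counts the parts of \<open>p\<close>
  exceeding \<open>j\<close>. The additive form avoids truncated subtraction.\<close>

lemma hook_length_Cons_0:
  assumes "j < a"
  shows "hook_length (a # p) (0, j) + (j + length (filter (\<lambda>v. v \<le> j) p)) = a + length p"
proof -
  have "{i'. 0 < i' \<and> i' < Suc (length p) \<and> j < (a # p) ! i'} =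
      Suc ` {i'. i' < length p \<and> j < p ! i'}"
    by (auto simp: image_iff gr0_conv_Suc)
  then have "card {i'. 0 < i' \<and> i' < Suc (length p) \<and> j < (a # p) ! i'} =
      length (filter (\<lambda>v. j < v) p)"
    by (simp add: card_image length_filter_conv_card)
  moreover have "{j'. j < j' \<and> j' < a} = {j<..<a}" by auto
  moreover have "length (filter (\<lambda>v. j < v) p) + length (filter (\<lambda>v. v \<le> j) p) = length p"
    using sum_length_filter_compl[of "\<lambda>v. j < v" p] by (simp add: not_less)
  ultimately show ?thesis
    using assms by (simp add: hook_length_def young_diagram_def)
qed

lemma is_core_Cons:
  "is_core t (a # p) \<longleftrightarrow> is_core t p \<and> (\<forall>j<a. hook_length (a # p) (0, j) \<noteq> t)"
proof -
  have "young_diagram (a # p) = Pair 0 ` {..<a} \<union> (\<lambda>(i, j). (Suc i, j)) ` young_diagram p"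
    by (auto simp: young_diagram_def image_iff nth_Cons split: nat.splits)
  then show ?thesis
    by (auto simp: is_core_def ball_Un hook_length_Cons_Suc)
qed

text \<open>The hook lengths in the first row are the differences between its first-column hook
  length and the smaller non-members of the beta set. So \<open>t\<close> is missing exactly when
  subtracting \<open>t\<close> does not lead to a non-member.\<close>

lemma is_core_iff_beta_set:
  assumes "is_partition p" "0 < t"
  shows "is_core t p \<longleftrightarrow> (\<forall>x\<in>beta_set p. t \<le> x \<longrightarrow> x - t \<in> beta_set p)"
  using assms(1)
proof (induction p)
  case Nil
  then show ?case by (simp add: is_core_def young_diagram_def)
next
  case (Cons a p)
  then have a: "\<forall>b\<in>set p. b \<le> a" and p: "is_partition p"
    by (auto simp: is_partition_Cons)
  let ?X = "a + length p"
  let ?g = "\<lambda>j. j + length (filter (\<lambda>v. v \<le> j) p)"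
  have "(\<forall>j<a. hook_length (a # p) (0, j) \<noteq> t) \<longleftrightarrow> (\<forall>j<a. t + ?g j \<noteq> ?X)"
    using hook_length_Cons_0[of _ a p] by (metis add_right_cancel)
  also have "\<dots> \<longleftrightarrow> (\<forall>y\<in>?g ` {..<a}. t + y \<noteq> ?X)"
    by auto
  also have "\<dots> \<longleftrightarrow> (\<forall>y\<in>{..<?X} - beta_set p. t + y \<noteq> ?X)"
    by (simp only: image_add_length_filter_le[OF p a])
  also have "\<dots> \<longleftrightarrow> (t \<le> ?X \<longrightarrow> ?X - t \<in> beta_set p)"
  proof
    assume "\<forall>y\<in>{..<?X} - beta_set p. t + y \<noteq> ?X"
    with \<open>0 < t\<close> show "t \<le> ?X \<longrightarrow> ?X - t \<in> beta_set p"
      by (auto dest!: bspec[of _ _ "?X - t"])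
  next
    assume *: "t \<le> ?X \<longrightarrow> ?X - t \<in> beta_set p"
    show "\<forall>y\<in>{..<?X} - beta_set p. t + y \<noteq> ?X"
    proof (intro ballI notI)
      fix y assume "y \<in> {..<?X} - beta_set p" "t + y = ?X"
      moreover from this have "?X - t = y" by linarith
      ultimately show False using * by auto
    qed
  qed
  finally have row: "(\<forall>j<a. hook_length (a # p) (0, j) \<noteq> t) \<longleftrightarrow>
      (t \<le> ?X \<longrightarrow> ?X - t \<in> beta_set p)" .
  \<comment> \<open>Subtracting \<open>t\<close> never yields \<open>?X\<close>, so inserting
    \<open>?X\<close> leaves the condition on the lower rows unchanged.\<close>
  have "x - t \<noteq> ?X" if "x \<in> beta_set p" for x
    using beta_set_less[OF a that] by simp
  moreover have "?X - t \<noteq> ?X" if "t \<le> ?X"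
    using \<open>0 < t\<close> that by simp
  ultimately show ?case
    unfolding is_core_Cons row Cons.IH[OF p] beta_set.simps by blast
qed

section \<open>Spaced sets\<close>

definition spaced :: "nat \<Rightarrow> nat set \<Rightarrow> bool" where
  "spaced d X \<longleftrightarrow> (\<forall>x\<in>X. \<forall>y\<in>X. x < y \<longrightarrow> x + d < y)"

lemma spacedD: "spaced d X \<Longrightarrow> x \<in> X \<Longrightarrow> y \<in> X \<Longrightarrow> x < y \<Longrightarrow> x + d < y"
  by (auto simp: spaced_def)

lemma spaced_empty [simp]: "spaced d {}"
  by (simp add: spaced_def)

lemma spaced_insert_greater:
  assumes "\<forall>x\<in>X. x < b"
  shows "spaced d (insert b X) \<longleftrightarrow> spaced d X \<and> (\<forall>x\<in>X. x + d < b)"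
  using assms by (auto simp: spaced_def)

lemma spaced_subset: "spaced d X \<Longrightarrow> Y \<subseteq> X \<Longrightarrow> spaced d Y"
  by (auto simp: spaced_def)

section \<open>Distinct parts as spacing of first-column hook lengths\<close>

lemma distinct_parts_Nil [simp]: "distinct_parts d []"
  by (simp add: distinct_parts_def)

lemma distinct_parts_Cons:
  "distinct_parts d (a # p) \<longleftrightarrow> (p \<noteq> [] \<longrightarrow> hd p + d \<le> a) \<and> distinct_parts d p"
  by (cases p) (auto simp: distinct_parts_def nth_Cons split: nat.splits)

text \<open>Only the largest element matters, which is \<open>hd p + length p - 1\<close>; the
  \<open>- 1\<close> turns the strict bound into a weak one.\<close>

lemma beta_set_add_less_iff:
  assumes "is_partition p"
  shows "(\<forall>x\<in>beta_set p. x + d < a + length p) \<longleftrightarrow> (p \<noteq> [] \<longrightarrow> hd p + d \<le> a)"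
proof (cases p)
  case (Cons b q)
  with assms have "\<forall>c\<in>set q. c \<le> b" by (simp add: is_partition_Cons)
  from beta_set_less[OF this] Cons show ?thesis by fastforce
qed auto

lemma distinct_parts_iff_spaced:
  "is_partition p \<Longrightarrow> distinct_parts d p \<longleftrightarrow> spaced d (beta_set p)"
proof (induction p)
  case (Cons a p)
  then have a: "\<forall>b\<in>set p. b \<le> a" and p: "is_partition p"
    by (auto simp: is_partition_Cons)
  have "\<forall>x\<in>beta_set p. x < a + length p"
    using beta_set_less[OF a] by blast
  then show ?case
    using Cons.IH[OF p] beta_set_add_less_iff[OF p]
    by (auto simp: distinct_parts_Cons spaced_insert_greater)
qed auto

text \<open>The cardinality gives the number of parts, and the maximum then gives the first
  part.\<close>

lemma beta_set_inject:
  "is_partition p \<Longrightarrow> is_partition q \<Longrightarrow> beta_set p = beta_set q \<Longrightarrow> p = q"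
proof (induction p arbitrary: q)
  case Nil
  then show ?case by (cases q) auto
next
  case (Cons a p)
  then obtain b q' where q: "q = b # q'" by (cases q) auto
  have len: "length p = length q'"
    using card_beta_set[OF Cons.prems(1)] card_beta_set[OF Cons.prems(2)] Cons.prems(3) q by simp
  have lt: "x < a + length p" if "x \<in> beta_set p" for x
    using Cons.prems(1) beta_set_less that by (auto simp: is_partition_Cons)
  have lt': "x < b + length q'" if "x \<in> beta_set q'" for x
    using Cons.prems(2) q beta_set_less that by (auto simp: is_partition_Cons)
  have eq: "insert (a + length p) (beta_set p) = insert (b + length q') (beta_set q')"
    using Cons.prems(3) q by simp
  then have "a + length p = b + length q'"
    using lt lt' by (metis insert_iff less_asym)
  moreover from this have "beta_set p = beta_set q'"
    using eq lt lt' by (metis insert_ident less_irrefl)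
  ultimately show ?case
    using Cons.IH[of q'] Cons.prems q len by (simp add: is_partition_Cons)
qed

text \<open>The maximum \<open>b\<close> becomes the part \<open>b - length p\<close>. It is
  positive because the \<open>length p\<close> other elements lie strictly between 0 and
  \<open>b\<close>, and it is at least the next part because the next element is below
  \<open>b\<close>.\<close>

lemma beta_set_surj:
  assumes "finite X" "0 \<notin> X"
  shows "\<exists>p. is_partition p \<and> beta_set p = X"
  using assms
proof (induction X rule: finite_linorder_max_induct)
  case empty
  then show ?case by (intro exI[of _ "[]"]) simp
next
  case (insert b A)
  then obtain p where p: "is_partition p" "beta_set p = A" by auto
  have "A \<subseteq> {0<..<b}" using insert by (auto intro: gr0I)
  then have "length p < b"
    using card_mono[of "{0<..<b}" A] card_beta_set[OF p(1)] p(2) insert.prems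
    by (cases b) auto
  moreover have "\<forall>c\<in>set p. c \<le> b - length p"
  proof (cases p)
    case (Cons c q)
    then have "c + length q < b" using insert.hyps p(2) by auto
    with p(1) Cons show ?thesis by (force simp: is_partition_Cons)
  qed auto
  ultimately show ?case
    using p by (intro exI[of _ "(b - length p) # p"]) (auto simp: is_partition_Cons)
qed

text \<open>The image of \<open>core_partitions\<close> under \<open>beta_set\<close>, for positive
  \<open>s\<close>. Finiteness and the exclusion of 0 describe which sets come from
  partitions.\<close>

definition core_sets :: "nat \<Rightarrow> nat \<Rightarrow> nat \<Rightarrow> nat set set" where
  "core_sets d r s = {X. finite X \<and> 0 \<notin> X \<and> spaced d X \<and>
     (\<forall>x\<in>X. s \<le> x \<longrightarrow> x - s \<in> X) \<and> (\<forall>x\<in>X. s + r \<le> x \<longrightarrow> x - (s + r) \<in> X)}"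

lemma bij_betw_beta_set:
  assumes "0 < s"
  shows "bij_betw beta_set (core_partitions d r s) (core_sets d r s)"
proof (rule bij_betw_imageI)
  show "inj_on beta_set (core_partitions d r s)"
    by (auto simp: inj_on_def core_partitions_def intro: beta_set_inject)
  have iff: "p \<in> core_partitions d r s \<longleftrightarrow> beta_set p \<in> core_sets d r s" if "is_partition p" for p
    using that assms is_core_iff_beta_set[OF that, of s] is_core_iff_beta_set[OF that, of "s + r"]
    by (auto simp: core_partitions_def core_sets_def distinct_parts_iff_spaced
        zero_notin_beta_set)
  show "beta_set ` core_partitions d r s = core_sets d r s"
  proof (intro equalityI subsetI)
    fix X assume "X \<in> beta_set ` core_partitions d r s"
    then show "X \<in> core_sets d r s"
      using iff by (auto simp: core_partitions_def)
  next
    fix X assume X: "X \<in> core_sets d r s"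
    then obtain p where "is_partition p" "beta_set p = X"
      using beta_set_surj[of X] by (auto simp: core_sets_def)
    then show "X \<in> beta_set ` core_partitions d r s"
      using iff X by blast
  qed
qed

section \<open>Counting\<close>

definition spaced_subsets :: "nat \<Rightarrow> nat \<Rightarrow> nat set set" where
  "spaced_subsets d n = {X. X \<subseteq> {1..n} \<and> spaced d X}"

lemma finite_spaced_subsets [simp]: "finite (spaced_subsets d n)"
  by (rule finite_subset[of _ "Pow {1..n}"]) (auto simp: spaced_subsets_def)

lemma card_spaced_subsets_0 [simp]: "card (spaced_subsets d 0) = 1"
proof -
  have "spaced_subsets d 0 = {{}}" by (auto simp: spaced_subsets_def)
  then show ?thesis by simp
qed

text \<open>Split by whether \<open>Suc n\<close> is a member; if so, the others are at most
  \<open>n - d\<close>. For \<open>n \<le> d\<close> truncation gives 0, which correctly counts the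
  single set \<open>{Suc n}\<close>.\<close>

lemma card_spaced_subsets_Suc:
  "card (spaced_subsets d (Suc n)) = card (spaced_subsets d n) + card (spaced_subsets d (n - d))"
proof -
  let ?T = "spaced_subsets d"
  have eq: "?T (Suc n) = ?T n \<union> insert (Suc n) ` ?T (n - d)"
  proof (intro equalityI subsetI)
    fix X assume X: "X \<in> ?T (Suc n)"
    show "X \<in> ?T n \<union> insert (Suc n) ` ?T (n - d)"
    proof (cases "Suc n \<in> X")
      case True
      let ?Y = "X - {Suc n}"
      have "x \<in> {1..n - d}" if "x \<in> ?Y" for x
      proof -
        have "1 \<le> x" "x < Suc n" using X that by (force simp: spaced_subsets_def)+
        moreover from this have "x + d < Suc n"
          using X that True by (auto simp: spaced_subsets_def intro: spacedD)
        ultimately show ?thesis by auto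
      qed
      then have "?Y \<subseteq> {1..n - d}" by blast
      then have "?Y \<in> ?T (n - d)"
        using X spaced_subset[of d X ?Y] by (simp add: spaced_subsets_def)
      moreover have "X = insert (Suc n) ?Y" using True by auto
      ultimately show ?thesis by blast
    next
      case False
      then show ?thesis using X
        by (auto simp: spaced_subsets_def subset_iff le_Suc_eq)
    qed
  next
    fix X assume "X \<in> ?T n \<union> insert (Suc n) ` ?T (n - d)"
    then consider "X \<in> ?T n" | Y where "X = insert (Suc n) Y" "Y \<in> ?T (n - d)" by blast
    then show "X \<in> ?T (Suc n)"
    proof cases
      case 1
      then show ?thesis by (auto simp: spaced_subsets_def)
    next
      case 2
      then have Y: "1 \<le> y \<and> y + d < Suc n" if "y \<in> Y" for y
        using that by (force simp: spaced_subsets_def)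
      then have "\<forall>y\<in>Y. y < Suc n" by force
      then show ?thesis
        using 2 Y spaced_insert_greater[of Y "Suc n" d] by (force simp: spaced_subsets_def)
    qed
  qed
  have notin: "Suc n \<notin> X" if "X \<in> ?T m" "m \<le> n" for X m
    using that by (auto simp: spaced_subsets_def)
  then have "?T n \<inter> insert (Suc n) ` ?T (n - d) = {}" by blast
  moreover have "inj_on (insert (Suc n)) (?T (n - d))"
    using notin[of _ "n - d"] by (intro inj_onI) (metis insert_ident diff_le_self)
  ultimately show ?thesis
    by (simp add: eq card_Un_disjoint card_image)
qed

section \<open>Core sets with and without an element above \<open>s\<close>\<close>

lemma core_sets_less:
  assumes "0 < r" "r \<le> d" "X \<in> core_sets d r s" "x \<in> X"
  shows "x < s + r"
proof (rule ccontr)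
  assume x: "\<not> x < s + r"
  then have "x - (s + r) \<in> X" "x - s \<in> X" and sp: "spaced d X"
    using assms by (auto simp: core_sets_def)
  then have "x - (s + r) + d < x - s"
    using x assms(1) by (intro spacedD[OF sp]) auto
  with assms(2) x show False by simp
qed

lemma core_sets_cases:
  assumes "0 < r" "r \<le> d" "0 < s" "X \<in> core_sets d r s"
  shows "X \<in> spaced_subsets d (s - 1) \<or> (\<exists>a\<in>{1..<r}. s + a \<in> X)"
proof -
  from assms(4) have X: "0 \<notin> X" "spaced d X" "\<And>x. x \<in> X \<Longrightarrow> s \<le> x \<Longrightarrow> x - s \<in> X"
    by (auto simp: core_sets_def)
  have "s \<notin> X" using X(1) X(3)[of s] by auto
  show ?thesis
  proof (cases "\<forall>x\<in>X. x < s")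
    case True
    then have "x \<in> {1..s - 1}" if "x \<in> X" for x
      using X(1) that by (cases x) force+
    with X(2) show ?thesis by (auto simp: spaced_subsets_def)
  next
    case False
    then obtain x where x: "x \<in> X" "s < x"
      using \<open>s \<notin> X\<close> by (metis nat_neq_iff)
    with core_sets_less[OF assms(1,2,4), of x] show ?thesis
      by (intro disjI2 bexI[of _ "x - s"]) auto
  qed
qed

text \<open>The element \<open>s + a\<close> forces \<open>a\<close>, so spacing requires
  \<open>d < s\<close>. The elements between them are shifted down by \<open>a + d\<close>. If
  \<open>d < s \<le> 2 * d + 1\<close>, the truncated bound is 0 and only \<open>{a, s + a}\<close>
  remains.\<close>

lemma core_sets_with_large_elem:
  assumes "0 < r" "r \<le> d" "0 < s" "a \<in> {1..<r}"
  shows "{X \<in> core_sets d r s. s + a \<in> X} =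
    (if d < s then (\<lambda>Y. insert (s + a) (insert a ((+) (a + d) ` Y))) ` spaced_subsets d (s - (2 * d + 1))
     else {})"
    (is "?L = (if _ then ?f ` ?T else _)")
proof -
  have d: "d < s" and im: "X \<in> ?f ` ?T" if X: "X \<in> core_sets d r s" "s + a \<in> X" for X
  proof -
    from X(1) have sp: "spaced d X" and "0 \<notin> X" and core: "\<And>x. x \<in> X \<Longrightarrow> s \<le> x \<Longrightarrow> x - s \<in> X"
      by (auto simp: core_sets_def)
    have a: "a \<in> X" using core[of "s + a"] X(2) by simp
    show "d < s" using spacedD[OF sp a X(2)] assms by simp
    define Y where "Y = {y. y + (a + d) \<in> X \<and> 1 \<le> y \<and> y + (a + d) < s + a}"
    \<comment> \<open>Spacing below \<open>s + a\<close> costs another \<open>d\<close>, which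
      yields the upper bound \<open>s - (2 * d + 1)\<close>.\<close>
    have bound: "y + d < s - d" if "y \<in> Y" for y
      using that spacedD[OF sp _ X(2), of "y + (a + d)"] by (simp add: Y_def)
    have "Y \<in> ?T"
      using bound sp by (fastforce simp: Y_def spaced_subsets_def spaced_def)
    moreover have "X = ?f Y"
    proof (intro equalityI subsetI)
      fix x assume x: "x \<in> X"
      have "x \<ge> a"
      proof (rule ccontr)
        assume "\<not> x \<ge> a"
        with spacedD[OF sp x a] assms show False by auto
      qed
      moreover have "x \<le> s + a"
      proof (rule ccontr)
        assume "\<not> x \<le> s + a"
        then have "s + a + d < x" using spacedD[OF sp X(2) x] by simp
        then show False
          using core_sets_less[OF assms(1,2) X(1) x] assms(2) by simp
      qed
      moreover have "x - (a + d) \<in> Y \<and> a + d \<le> x" if "a < x" "x < s + a"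
        using spacedD[OF sp a x] that x by (auto simp: Y_def)
      then have "x \<in> (+) (a + d) ` Y" if "a < x" "x < s + a"
        using that by (intro image_eqI[of _ _ "x - (a + d)"]) auto
      ultimately show "x \<in> ?f Y" by force
    next
      fix x assume "x \<in> ?f Y"
      then show "x \<in> X" using a X(2) by (auto simp: Y_def add_ac)
    qed
    ultimately show "X \<in> ?f ` ?T" by blast
  qed
  have "?f Y \<in> ?L" if "d < s" "Y \<in> ?T" for Y
  proof -
    have Y: "1 \<le> y \<and> y + (2 * d + 1) \<le> s" if "y \<in> Y" for y
      using \<open>Y \<in> ?T\<close> that by (force simp: spaced_subsets_def)
    have "finite Y" "spaced d Y"
      using \<open>Y \<in> ?T\<close> finite_subset by (auto simp: spaced_subsets_def)
    have "spaced d (?f Y)"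
      unfolding spaced_def
    proof (intro ballI impI)
      fix x y assume "x \<in> ?f Y" "y \<in> ?f Y" "x < y"
      then show "x + d < y"
        using \<open>d < s\<close> by (auto dest: Y spacedD[OF \<open>spaced d Y\<close>])
    qed
    \<comment> \<open>Since \<open>a < r \<le> d < s\<close>, the only element not below
      \<open>s\<close> is \<open>s + a\<close>. Subtracting \<open>s\<close> from it gives
      \<open>a\<close>, and the condition for \<open>s + r\<close> is vacuous.\<close>
    then show ?thesis
      using assms \<open>finite Y\<close> \<open>d < s\<close> by (auto simp: core_sets_def dest!: Y)
  qed
  with d im show ?thesis by (auto split: if_splits)
qed

lemma card_core_sets_with_large_elem:
  assumes "0 < r" "r \<le> d" "0 < s" "a \<in> {1..<r}"
  shows "finite {X \<in> core_sets d r s. s + a \<in> X}"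
    and "card {X \<in> core_sets d r s. s + a \<in> X} =
      (if d < s then card (spaced_subsets d (s - (2 * d + 1))) else 0)"
proof -
  let ?T = "spaced_subsets d (s - (2 * d + 1))"
  let ?f = "\<lambda>Y. insert (s + a) (insert a ((+) (a + d) ` Y))"
  have "inj_on ?f ?T"
  \<comment> \<open>The bound \<open>1 \<le> y\<close> discards the element \<open>a\<close>, and
    \<open>y + d < s\<close> discards \<open>s + a\<close>.\<close>
  proof (rule inj_on_inverseI[where g = "\<lambda>X. {y. 1 \<le> y \<and> y + d < s \<and> a + d + y \<in> X}"])
    fix Y assume "Y \<in> ?T"
    then have "1 \<le> y \<and> y + (2 * d + 1) \<le> s" if "y \<in> Y" for y
      using that by (force simp: spaced_subsets_def)
    then show "{y. 1 \<le> y \<and> y + d < s \<and> a + d + y \<in> ?f Y} = Y"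
      by force
  qed
  then show "card {X \<in> core_sets d r s. s + a \<in> X} = (if d < s then card ?T else 0)"
    by (simp add: core_sets_with_large_elem[OF assms] card_image)
  show "finite {X \<in> core_sets d r s. s + a \<in> X}"
    by (simp add: core_sets_with_large_elem[OF assms])
qed

lemma num_cores_eq:
  assumes "0 < r" "r \<le> d" "0 < s"
  shows "num_cores d r s = card (spaced_subsets d (s - 1)) +
    (if d < s then (r - 1) * card (spaced_subsets d (s - (2 * d + 1))) else 0)"
proof -
  let ?B = "\<lambda>a. {X \<in> core_sets d r s. s + a \<in> X}"
  have sub: "spaced_subsets d (s - 1) \<subseteq> core_sets d r s"
  proof
    fix X assume X: "X \<in> spaced_subsets d (s - 1)"
    then have "finite X" by (auto simp: spaced_subsets_def intro: finite_subset)
    moreover have "x < s \<and> x \<noteq> 0" if "x \<in> X" for x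
      using X that assms(3) by (force simp: spaced_subsets_def)
    ultimately show "X \<in> core_sets d r s"
      using X by (force simp: core_sets_def spaced_subsets_def)
  qed
  have eq: "core_sets d r s = spaced_subsets d (s - 1) \<union> (\<Union>a\<in>{1..<r}. ?B a)"
    using core_sets_cases[OF assms] sub by blast
  have "spaced_subsets d (s - 1) \<inter> (\<Union>a\<in>{1..<r}. ?B a) = {}"
    using assms by (force simp: spaced_subsets_def)
  moreover have fin: "finite (?B a)" if "a \<in> {1..<r}" for a
    using card_core_sets_with_large_elem(1)[OF assms that] .
  moreover have "card (\<Union>a\<in>{1..<r}. ?B a) = (\<Sum>a\<in>{1..<r}. card (?B a))"
  proof (rule card_UN_disjoint)
    show "\<forall>a\<in>{1..<r}. \<forall>b\<in>{1..<r}. a \<noteq> b \<longrightarrow> ?B a \<inter> ?B b = {}"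
    proof (intro ballI impI equals0I)
      fix a b X assume ab: "a \<in> {1..<r}" "b \<in> {1..<r}" "a \<noteq> b" and "X \<in> ?B a \<inter> ?B b"
      then have "spaced d X" "s + a \<in> X" "s + b \<in> X" by (auto simp: core_sets_def)
      \<comment> \<open>Two such elements would differ by less than \<open>r\<close>, hence by less
        than \<open>d\<close>.\<close>
      from spacedD[OF this] spacedD[OF this(1,3,2)] ab assms(2) show False by (cases "a < b") auto
    qed
  qed (use fin in auto)
  ultimately have "card (core_sets d r s) =
      card (spaced_subsets d (s - 1)) + (\<Sum>a\<in>{1..<r}. card (?B a))"
    by (subst eq, subst card_Un_disjoint) auto
  also have "(\<Sum>a\<in>{1..<r}. card (?B a)) =
      (\<Sum>a\<in>{1..<r}. if d < s then card (spaced_subsets d (s - (2 * d + 1))) else 0)"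
    by (rule sum.cong) (use card_core_sets_with_large_elem(2)[OF assms] in auto)
  finally show ?thesis
    using bij_betw_same_card[OF bij_betw_beta_set[OF assms(3)], of d r]
    by (simp add: num_cores_def)
qed

section \<open>The generating function\<close>

text \<open>Truncation makes \<open>F (n - d)\<close> equal to 1 for \<open>n \<le> d\<close>. So
  the first product, before the factor \<open>1 - fps_X\<close>, is the sum of the powers of
  \<open>fps_X\<close> up to \<open>d\<close> rather than 1. The second equation is the recurrence
  read as a difference.\<close>

lemma fps_recurrence_truncated:
  fixes F :: "nat \<Rightarrow> 'a::comm_ring_1"
  assumes "F 0 = 1" "\<And>n. F (Suc n) = F n + F (n - d)"
  shows "Abs_fps F * (1 - fps_X - fps_X ^ (d + 1)) * (1 - fps_X) = 1 - fps_X ^ (d + 1)"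
    and "fps_X * Abs_fps (\<lambda>n. F (n - d)) = Abs_fps F * (1 - fps_X) - 1"
proof -
  let ?A = "Abs_fps F"
  have "?A * (1 - fps_X - fps_X ^ (d + 1)) = ?A - fps_X * ?A - fps_X ^ (d + 1) * ?A"
    by (simp add: algebra_simps)
  also have "\<dots> = Abs_fps (\<lambda>n. if n \<le> d then 1 else 0)"
  proof (rule fps_ext)
    fix n
    show "fps_nth (?A - fps_X * ?A - fps_X ^ (d + 1) * ?A) n =
        fps_nth (Abs_fps (\<lambda>n. if n \<le> d then 1 else 0)) n"
      using assms by (cases n) (auto simp: fps_X_power_mult_nth simp del: power_Suc)
  qed
  finally have *: "?A * (1 - fps_X - fps_X ^ (d + 1)) = Abs_fps (\<lambda>n. if n \<le> d then 1 else 0)" .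
  have "Abs_fps (\<lambda>n. if n \<le> d then 1 else (0::'a)) * (1 - fps_X) = 1 - fps_X ^ (d + 1)"
    (is "?E * _ = _")
  proof (rule fps_ext)
    fix n
    have "?E * (1 - fps_X) = ?E - fps_X * ?E" by (simp add: algebra_simps)
    then show "fps_nth (?E * (1 - fps_X)) n = fps_nth (1 - fps_X ^ (d + 1)) n"
      by (cases n) (auto simp: fps_X_power_nth simp del: power_Suc)
  qed
  with * show "?A * (1 - fps_X - fps_X ^ (d + 1)) * (1 - fps_X) = 1 - fps_X ^ (d + 1)"
    by simp
  have "?A * (1 - fps_X) - 1 = ?A - fps_X * ?A - 1" by (simp add: algebra_simps)
  also have "\<dots> = fps_X * Abs_fps (\<lambda>n. F (n - d))"
  proof (rule fps_ext)
    fix n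
    show "fps_nth (?A - fps_X * ?A - 1) n = fps_nth (fps_X * Abs_fps (\<lambda>n. F (n - d))) n"
      using assms by (cases n) auto
  qed
  finally show "fps_X * Abs_fps (\<lambda>n. F (n - d)) = ?A * (1 - fps_X) - 1" ..
qed

theorem theorem5p2:
  fixes d r :: nat
  assumes "0 < r" and "r \<le> d"
  shows "core_gf d r =
    fps_X * (1 + (of_nat r - 1) * fps_X ^ d - of_nat r * fps_X ^ (d + 1)) /
      ((1 - fps_X - fps_X ^ (d + 1)) * (1 - fps_X))"
proof -
  define F :: "nat \<Rightarrow> rat" where "F n = of_nat (card (spaced_subsets d n))" for n
  define A where "A = Abs_fps F"
  define C where "C = Abs_fps (\<lambda>n. F (n - d))"
  define x :: "rat fps" where "x = fps_X"
  define D where "D = 1 - x - x ^ (d + 1)"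
  define R :: "rat fps" where "R = of_nat r"
  have "F 0 = 1" "\<And>n. F (Suc n) = F n + F (n - d)"
    by (simp_all add: F_def card_spaced_subsets_Suc)
  note rec = fps_recurrence_truncated[OF this, folded A_def C_def x_def, folded D_def]
  \<comment> \<open>The factor \<open>x ^ (d + 1)\<close> encodes the condition
    \<open>d < s\<close>; the remaining shift by \<open>d\<close> is the truncated one inside
    \<open>C\<close>.\<close>
  have gf: "core_gf d r = x * A + (R - 1) * (x ^ (d + 1) * C)"
  proof (rule fps_ext)
    fix n
    have R: "R - 1 = fps_const (of_nat (r - 1))"
      using assms by (simp add: R_def of_nat_diff fps_of_nat flip: fps_const_sub)
    show "fps_nth (core_gf d r) n = fps_nth (x * A + (R - 1) * (x ^ (d + 1) * C)) n"
    proof (cases n)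
      case 0
      then show ?thesis
        by (simp add: core_gf_def x_def)
    next
      case (Suc m)
      have "m - d - d = Suc m - (2 * d + 1)" by simp
      with Suc show ?thesis
        using num_cores_eq[OF assms, of n]
        by (auto simp: R core_gf_def x_def A_def C_def F_def fps_X_power_mult_nth simp del: power_Suc)
    qed
  qed
  have "core_gf d r * (D * (1 - x)) =
      x * (A * D * (1 - x)) + (R - 1) * x ^ d * (x * C) * (D * (1 - x))"
    by (simp add: gf algebra_simps)
  \<comment> \<open>Eliminating \<open>C\<close> leaves \<open>A\<close> only in the product
    \<open>A * D * (1 - x)\<close>, which is a known polynomial.\<close>
  also have "\<dots> = x * (A * D * (1 - x)) + (R - 1) * x ^ d * ((1 - x) * (A * D * (1 - x)) - D * (1 - x))"
    unfolding rec(2) by (simp add: algebra_simps)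
  also have "\<dots> = x * (1 + (R - 1) * x ^ d - R * x ^ (d + 1))"
    unfolding rec(1) by (simp add: D_def algebra_simps)
  finally have "core_gf d r * (D * (1 - x)) = x * (1 + (R - 1) * x ^ d - R * x ^ (d + 1))" .
  \<comment> \<open>The constant term shows that the denominator is nonzero, so it can be
    cancelled.\<close>
  moreover have "fps_nth (D * (1 - x)) 0 = 1"
    by (simp add: D_def x_def)
  then have "D * (1 - x) \<noteq> 0" by (metis fps_zero_nth zero_neq_one)
  ultimately have "core_gf d r = x * (1 + (R - 1) * x ^ d - R * x ^ (d + 1)) / (D * (1 - x))"
    by (metis nonzero_mult_div_cancel_right)
  then show ?thesis
    by (simp only: x_def D_def R_def)
qed

end
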